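(* Let $|\psi\rangle$ be a quantum state and let $\widetilde O$ be a random matrix with $\|\widetilde O\|\le1$ whose expectation $\mathbb{E}\widetilde O$ is Hermitian. Suppose we are given access to a state preparation oracle $O_\psi$ of $|\psi\rangle$ and a random block-encoding $U_{\widetilde O}$ of $\widetilde O$. Then the Hadamard-test algorithm for non-unitary random matrices (described in the context) outputs an $\epsilon$-approximation of $\langle\psi|\mathbb{E}\widetilde O|\psi\rangle$ with probability at least $1-\delta$, using queries to $O_\psi$ and $U_{\widetilde O}$ for $M$ times, where $$M=\mathcal{O}\left(\frac1{\epsilon^2}\log\left(\frac1\delta\right)\right).$$
   Context: Block-encoding: a unitary $U_{B}$ is a block-encoding of a matrix $B$ if $B=(\langle 0|^{\otimes a}\otimes I)\,U_B\,(|0\rangle^{\otimes a}\otimes I)$ for some number $a$ of ancilla qubits. $\|\cdot\|$ is the spectral norm. A random block-encoding $U_{\widetilde O}$ is a random unitary that is, for each sample, a block-encoding of the corresponding sample of $\widetilde O$; each use in a new run draws an independent sample. The state preparation oracle is a unitary with $O_\psi|0\rangle=|\psi\rangle$. Here $\epsilon,\delta\in(0,1)$. Hadamard-test algorithm with parameter $M$: for each $m=1,\dots,M$, run independently the following circuit on (control qubit)$\otimes$(block-encoding ancillas)$\otimes$(system), initialized in $|0\rangle|0\rangle|0\rangle$: apply $O_\psi$ to the system register and a Hadamard gate to the control qubit; apply a fresh sample of $U_{\widetilde O}$ on ancillas and system, controlled on the control qubit being $|1\rangle$; apply a Hadamard gate to the control qubit; measure the control qubit and the block-encoding ancillas in the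 computational basis. Set $\widetilde o_m=1$ if the outcome is $|0\rangle|0\rangle$, $\widetilde o_m=-1$ if the outcome is $|1\rangle|0\rangle$, and $\widetilde o_m=0$ otherwise (the first ket is the control qubit, the second the ancilla register). Output $\frac1M\sum_{m=1}^M\widetilde o_m$. *)

theory Defs
  imports "HOL-Probability.Probability" "HOL-Library.Landau_Symbols"
begin

type_synonym 'a vector = "(complex, 'a) vec"
type_synonym 'a op = "((complex, 'a) vec, 'a) vec"

text \<open>
  A register with computational basis indexed by a finite type \<open>'a\<close> is the space \<open>'a vector\<close>;
  the basis label \<open>0 :: 'a\<close> plays the role of the all-zero string, and registers are
  composed by taking products of index types. A register of \<open>k\<close> qubits is a type with
  \<open>CARD('a) = 2 ^ k\<close>; the case \<open>k = 0\<close> (one basis state) is included. In the qubit type \<open>2\<close>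
  the two labels are \<open>0\<close> and \<open>1\<close>.
\<close>

definition ket :: "'a::finite \<Rightarrow> 'a vector" where
  "ket i = axis i 1"

definition dagger :: "complex^'n::finite^'m::finite \<Rightarrow> complex^'m^'n" where
  "dagger A = (\<chi> i j. cnj (A $ j $ i))"

definition unitary :: "'n::finite op \<Rightarrow> bool" where
  "unitary U \<longleftrightarrow> U ** dagger U = mat 1 \<and> dagger U ** U = mat 1"

definition hermitian :: "'n::finite op \<Rightarrow> bool" where
  "hermitian A \<longleftrightarrow> dagger A = A"

abbreviation spectral_norm :: "complex^'n::finite^'m::finite \<Rightarrow> real" where
  "spectral_norm A \<equiv> onorm ((*v) A)"

text \<open>The complex number \<open>\<langle>u|A|v\<rangle>\<close>; the library's \<open>inner\<close> on \<open>complex^'n\<close> is only its real part.\<close>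

definition sandwich :: "complex^'m::finite \<Rightarrow> complex^'n::finite^'m \<Rightarrow> complex^'n \<Rightarrow> complex" where
  "sandwich u A v = (\<Sum>i\<in>UNIV. cnj (u $ i) * (A *v v) $ i)"

definition ketbra :: "complex^'m::finite \<Rightarrow> complex^'n::finite \<Rightarrow> complex^'n^'m" where
  "ketbra u v = (\<chi> i j. u $ i * cnj (v $ j))"

definition kron :: "complex^'n::finite^'m::finite \<Rightarrow> complex^'q::finite^'p::finite
    \<Rightarrow> complex^('n \<times> 'q)^('m \<times> 'p)" where
  "kron A B = (\<chi> r s. A $ fst r $ fst s * B $ snd r $ snd s)"

text \<open>
  The rectangular matrix \<open>|u\<rangle> \<otimes> I\<close>. It is not an instance of \<open>kron\<close> because
  the column index is \<open>'s\<close> and not \<open>1 \<times> 's\<close>.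
\<close>

definition ket_tensor_id :: "complex^'a::finite \<Rightarrow> complex^'s::finite^('a \<times> 's)" where
  "ket_tensor_id u = (\<chi> r k. u $ fst r * (mat 1 :: complex^'s^'s) $ snd r $ k)"

definition block_encoding ::
    "('a::{finite,zero} \<times> 's::finite) op \<Rightarrow> 's op \<Rightarrow> bool" where
  "block_encoding U B \<longleftrightarrow>
     (\<exists>a. CARD('a) = 2 ^ a) \<and> unitary U \<and>
     B = dagger (ket_tensor_id (ket (0::'a))) ** U ** ket_tensor_id (ket (0::'a))"

definition hadamard :: "2 op" where
  "hadamard = (\<chi> i j. (if i = 1 \<and> j = 1 then -1 else 1) / of_real (sqrt 2))"

definition controlled :: "'n::finite op \<Rightarrow> (2 \<times> 'n) op" where
  "controlled U = kron (ketbra (ket 0) (ket 0)) (mat 1) + kron (ketbra (ket 1) (ket 1)) U"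

text \<open>State of (control qubit) \<open>\<otimes>\<close> (ancillas) \<open>\<otimes>\<close> (system) just before the measurement.\<close>

definition hadamard_test_state ::
    "'s::{finite,zero} op \<Rightarrow> ('a::{finite,zero} \<times> 's) op
      \<Rightarrow> (2 \<times> 'a \<times> 's) vector" where
  "hadamard_test_state P U =
     kron hadamard (mat 1) *v
       (controlled U *v
         (kron hadamard (kron (mat 1) P) *v ket (0, 0, 0)))"

text \<open>
  Born rule for measuring the control qubit and the ancillas: outcome \<open>(c, j)\<close> has probability
  \<open>\<parallel>(\<langle>c| \<otimes> \<langle>j| \<otimes> I) v\<parallel>\<^sup>2\<close>.
\<close>

definition measure_control_ancilla ::
    "(2 \<times> 'a::finite \<times> 's::finite) vector \<Rightarrow> (2 \<times> 'a) measure" where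
  "measure_control_ancilla v =
     point_measure UNIV (\<lambda>(c, j). ennreal
       ((norm (dagger (ket_tensor_id (ket j)) *v (dagger (ket_tensor_id (ket c)) *v v)))\<^sup>2))"

text \<open>One run: draw a sample of the random unitary, then run the circuit on that sample.\<close>

definition hadamard_test_run ::
    "'w measure \<Rightarrow> 's::{finite,zero} op
      \<Rightarrow> ('w \<Rightarrow> ('a::{finite,zero} \<times> 's) op) \<Rightarrow> (2 \<times> 'a) measure" where
  "hadamard_test_run \<Omega> P U =
     \<Omega> \<bind> (\<lambda>\<omega>. measure_control_ancilla (hadamard_test_state P (U \<omega>)))"

text \<open>
  Joint law of the outcomes of \<open>M\<close> independent runs. Each run uses \<open>P\<close> once and a fresh
  sample of \<open>U\<close> once.
\<close>

definition hadamard_test ::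
    "nat \<Rightarrow> 'w measure \<Rightarrow> 's::{finite,zero} op
      \<Rightarrow> ('w \<Rightarrow> ('a::{finite,zero} \<times> 's) op) \<Rightarrow> (nat \<Rightarrow> 2 \<times> 'a) measure" where
  "hadamard_test M \<Omega> P U = Pi\<^sub>M {1..M} (\<lambda>_. hadamard_test_run \<Omega> P U)"

definition outcome_value :: "2 \<times> 'a::zero \<Rightarrow> real" where
  "outcome_value x = (if x = (0, 0) then 1 else if x = (1, 0) then -1 else 0)"

definition hadamard_test_output :: "nat \<Rightarrow> (nat \<Rightarrow> 2 \<times> 'a::zero) \<Rightarrow> real" where
  "hadamard_test_output M x = (\<Sum>m = 1..M. outcome_value (x m)) / real M"

text \<open>
  The number of runs that Hoeffding's inequality gives for independent variables with values
  in \<open>[-1, 1]\<close>. It is a monomorphic constant, so that it cannot depend on the dimensions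
  of the registers, which are types.
\<close>

definition num_runs :: "real \<Rightarrow> real \<Rightarrow> nat" where
  "num_runs \<epsilon> \<delta> = nat \<lceil>2 / \<epsilon>\<^sup>2 * ln (2 / \<delta>)\<rceil>"

end

theory Submission imports Defs begin

text \<open>
  With \<open>\<phi> = |0\<rangle> \<otimes> |\<psi>\<rangle>\<close>, the components of the final state with control qubit \<open>|0\<rangle>\<close> and \<open>|1\<rangle>\<close>
  are \<open>(\<phi> + U\<phi>) / 2\<close> and \<open>(\<phi> - U\<phi>) / 2\<close>. Projecting the ancillas onto \<open>|0\<rangle>\<close> turns \<open>\<phi>\<close> into \<open>\<psi>\<close>
  and \<open>U\<phi>\<close> into \<open>B\<psi>\<close>, where \<open>B\<close> is the encoded matrix, so by polarization the two relevant
  outcome probabilities differ by \<open>Re \<langle>\<psi>|B|\<psi>\<rangle>\<close>. Averaging over the random sample gives the real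
  part of \<open>\<langle>\<psi>|E B|\<psi>\<rangle>\<close>, which is a real number because \<open>E B\<close> is Hermitian, and Hoeffding's
  inequality for variables with values in \<open>[-1, 1]\<close> controls the mean of the independent runs.
\<close>

section \<open>Finite index sums, adjoints and quadratic forms\<close>

lemma UNIV_qubit: "(UNIV :: 2 set) = {0, 1}"
proof -
  \<comment> \<open>The type \<open>2\<close> is arithmetic modulo 2, so the numeral 2 in
    \<open>UNIV_2\<close> is another name for the label 0.\<close>
  have "(2 :: 2) = 0" by simp
  then show ?thesis using UNIV_2 by (metis insert_commute)
qed

lemma sum_UNIV_times:
  fixes f :: "'a::finite \<times> 'b::finite \<Rightarrow> 'c::comm_monoid_add"
  shows "(\<Sum>r\<in>UNIV. f r) = (\<Sum>i\<in>UNIV. \<Sum>j\<in>UNIV. f (i, j))"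
  by (simp add: sum.cartesian_product flip: UNIV_Times_UNIV)

lemma sum_UNIV_of_bool:
  fixes f :: "'a::finite \<Rightarrow> 'b::semiring_1"
  shows "(\<Sum>i\<in>UNIV. f i * of_bool (i = a)) = f a" "(\<Sum>i\<in>UNIV. of_bool (i = a) * f i) = f a"
    "(\<Sum>i\<in>UNIV. f i * of_bool (a = i)) = f a" "(\<Sum>i\<in>UNIV. of_bool (a = i) * f i) = f a"
proof -
  have "(\<Sum>i\<in>UNIV. f i * of_bool (i = a)) = (\<Sum>i\<in>UNIV. if i = a then f i else 0)"
    "(\<Sum>i\<in>UNIV. of_bool (i = a) * f i) = (\<Sum>i\<in>UNIV. if i = a then f i else 0)"
    "(\<Sum>i\<in>UNIV. f i * of_bool (a = i)) = (\<Sum>i\<in>UNIV. if i = a then f i else 0)"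
    "(\<Sum>i\<in>UNIV. of_bool (a = i) * f i) = (\<Sum>i\<in>UNIV. if i = a then f i else 0)"
    by (auto intro!: sum.cong)
  then show "(\<Sum>i\<in>UNIV. f i * of_bool (i = a)) = f a" "(\<Sum>i\<in>UNIV. of_bool (i = a) * f i) = f a"
    "(\<Sum>i\<in>UNIV. f i * of_bool (a = i)) = f a" "(\<Sum>i\<in>UNIV. of_bool (a = i) * f i) = f a"
    by simp_all
qed

lemma ket_nth: "ket i $ j = of_bool (j = i)"
  by (simp add: ket_def axis_def)

lemma cnj_of_bool: "cnj (of_bool b) = of_bool b"
  by (cases b) simp_all

lemma mat_1_nth: "mat 1 $ i $ j = of_bool (i = j)"
  by (simp add: mat_def)

text \<open>The real inner product is the real part of the Hermitian one, so the adjoint relation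
  survives. It turns an isometry equation into preservation of norms.\<close>

lemma inner_dagger:
  fixes A :: "complex^'n::finite^'m::finite"
  shows "(A *v x) \<bullet> y = x \<bullet> (dagger A *v y)"
proof -
  have "(A *v x) \<bullet> y = (\<Sum>i\<in>UNIV. \<Sum>j\<in>UNIV. Re (A $ i $ j * x $ j * cnj (y $ i)))"
    by (simp add: inner_vec_def matrix_vector_mult_def inner_complex_def sum_distrib_right
        sum.distrib sum_subtractf sum_negf ring_distribs)
  also have "\<dots> = (\<Sum>j\<in>UNIV. \<Sum>i\<in>UNIV. Re (A $ i $ j * x $ j * cnj (y $ i)))"
    by (rule sum.swap)
  also have "\<dots> = x \<bullet> (dagger A *v y)"
    by (auto simp: inner_vec_def matrix_vector_mult_def inner_complex_def dagger_def
        sum_distrib_left algebra_simps simp flip: sum.distrib sum_subtractf intro!: sum.cong)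
  finally show ?thesis .
qed

lemma norm_mult_isometry:
  fixes A :: "complex^'n::finite^'m::finite"
  assumes "dagger A ** A = mat 1"
  shows "norm (A *v x) = norm x"
  using inner_dagger[of A x "A *v x"] assms
  by (simp add: norm_eq_sqrt_inner matrix_vector_mul_assoc)

lemma sandwich_Re: "Re (sandwich u A v) = u \<bullet> (A *v v)"
  by (simp add: sandwich_def inner_vec_def inner_complex_def)

text \<open>Conjugating the double sum and exchanging its indices gives the same sum back.\<close>

lemma sandwich_hermitian_real:
  assumes "hermitian A"
  shows "Im (sandwich u A u) = 0"
proof -
  have A: "cnj (A $ i $ j) = A $ j $ i" for i j
    using assms by (metis (no_types, lifting) hermitian_def dagger_def vec_lambda_beta)
  have "cnj (sandwich u A u) = (\<Sum>i\<in>UNIV. \<Sum>j\<in>UNIV. u $ i * cnj (A $ i $ j) * cnj (u $ j))"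
    by (simp add: sandwich_def matrix_vector_mult_def sum_distrib_left mult_ac)
  also have "\<dots> = (\<Sum>j\<in>UNIV. \<Sum>i\<in>UNIV. u $ i * cnj (A $ i $ j) * cnj (u $ j))"
    by (rule sum.swap)
  also have "\<dots> = sandwich u A u"
    by (simp add: sandwich_def matrix_vector_mult_def sum_distrib_left A mult_ac)
  finally show ?thesis
    by (simp add: complex_eq_iff)
qed

section \<open>Ancilla slices and block-encodings\<close>

lemma ket_tensor_id_mult_nth: "(ket_tensor_id u *v x) $ (a, k) = u $ a * x $ k"
  by (simp add: ket_tensor_id_def matrix_vector_mult_def mat_1_nth mult.assoc sum_UNIV_of_bool
      flip: sum_distrib_left)

lemma dagger_ket_tensor_id_mult:
  "dagger (ket_tensor_id (ket a)) *v (x :: complex^('a::finite \<times> 's::finite)) = (\<chi> k. x $ (a, k))"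
  by (simp add: vec_eq_iff dagger_def ket_tensor_id_def matrix_vector_mult_def mat_1_nth ket_nth cnj_of_bool
      sum_UNIV_times sum_UNIV_of_bool mult.assoc flip: sum_distrib_left)

lemma ket_tensor_id_isometry:
  "dagger (ket_tensor_id (ket (a :: 'a::finite))) ** ket_tensor_id (ket a)
     = (mat 1 :: complex^'s::finite^'s)"
  by (simp add: vec_eq_iff matrix_matrix_mult_def dagger_def ket_tensor_id_def mat_1_nth ket_nth cnj_of_bool
      sum_UNIV_times sum_UNIV_of_bool mult.assoc flip: sum_distrib_left)

text \<open>Pythagoras: the slices partition the coordinates. It splits the final state along the
  control qubit and makes the Born probabilities sum to one.\<close>

lemma sum_norm_blocks:
  fixes x :: "complex^('a::finite \<times> 's::finite)"
  shows "(\<Sum>a\<in>UNIV. (norm (dagger (ket_tensor_id (ket a)) *v x))\<^sup>2) = (norm x)\<^sup>2"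
  by (simp add: dagger_ket_tensor_id_mult norm_vec_def L2_set_def sum_nonneg sum_UNIV_times)

text \<open>The circuit analysis uses the block-encoding only through these two facts. The first
  regroups the defining product, the second composes two isometries.\<close>

lemma block_encodingD:
  fixes U :: "('a::{finite,zero} \<times> 's::finite) op" and x :: "'s vector"
  assumes "block_encoding U B"
  defines "\<phi> \<equiv> ket_tensor_id (ket (0::'a)) *v x"
  shows "dagger (ket_tensor_id (ket (0::'a))) *v (U *v \<phi>) = B *v x"
    and "norm (U *v \<phi>) = norm x"
proof -
  have U: "dagger U ** U = mat 1"
      "B = dagger (ket_tensor_id (ket (0::'a))) ** U ** ket_tensor_id (ket (0::'a))"
    using assms by (simp_all add: block_encoding_def unitary_def)
  show "dagger (ket_tensor_id (ket (0::'a))) *v (U *v \<phi>) = B *v x"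
    by (simp add: U(2) \<phi>_def matrix_vector_mul_assoc matrix_mul_assoc)
  show "norm (U *v \<phi>) = norm x"
    by (simp add: norm_mult_isometry[OF U(1)] norm_mult_isometry[OF ket_tensor_id_isometry] \<phi>_def)
qed

section \<open>The state before the measurement\<close>

lemma kron_mult_nth:
  "(kron A B *v x) $ (c, r) = (\<Sum>d\<in>UNIV. A $ c $ d * (B *v (\<chi> s. x $ (d, s))) $ r)"
  by (simp add: kron_def matrix_vector_mult_def sum_UNIV_times sum_distrib_left mult.assoc)

lemma controlled_mult_block:
  "(\<chi> r. (controlled U *v x) $ (c, r)) = (if c = 0 then mat 1 else U) *v (\<chi> r. x $ (c, r))"
proof -
  have "c = 0 \<or> c = 1"
    using UNIV_qubit by auto
  then show ?thesis
    by (auto simp: vec_eq_iff controlled_def matrix_vector_mult_add_rdistrib kron_mult_nth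
        ketbra_def ket_nth UNIV_qubit)
qed

lemma hadamard_nth: "hadamard $ i $ j = (if i = 1 \<and> j = 1 then -1 else 1) / of_real (sqrt 2)"
  by (simp add: hadamard_def)

text \<open>The first Hadamard gate puts \<phi> / sqrt 2 in both control slices, the controlled gate
  applies \<open>U\<close> to slice 1, and the second Hadamard gate forms the sum and the difference
  with another factor 1 / sqrt 2.\<close>

lemma hadamard_test_state_block:
  fixes U :: "('a::{finite,zero} \<times> 's::{finite,zero}) op" and P :: "'s op"
  defines "\<phi> \<equiv> ket_tensor_id (ket (0::'a)) *v (P *v ket 0)"
  shows "dagger (ket_tensor_id (ket c)) *v hadamard_test_state P U
           = (1 / 2) *\<^sub>R (if c = 0 then \<phi> + U *v \<phi> else \<phi> - U *v \<phi>)"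
proof -
  let ?h = "1 / complex_of_real (sqrt 2)"
  let ?x = "kron hadamard (kron (mat 1) P) *v ket (0, 0, 0) :: (2 \<times> 'a \<times> 's) vector"
  have c: "c = 0 \<or> c = 1"
    using UNIV_qubit by auto
  \<comment> \<open>The system slices of the initial state are \<open>ket 0\<close> or zero; folding
    these coordinate forms back lets \<open>P\<close> act on whole vectors.\<close>
  have ket: "(\<chi> k. of_bool (k = 0)) = (ket 0 :: 's vector)" "(\<chi> k. 0) = (0 :: 's vector)"
    by (simp_all add: vec_eq_iff ket_nth)
  have x: "(\<chi> r. ?x $ (d, r)) = ?h *s \<phi>" for d
    by (auto simp: vec_eq_iff kron_mult_nth ket mat_1_nth UNIV_qubit hadamard_nth
        \<phi>_def ket_tensor_id_mult_nth ket_nth sum_UNIV_of_bool)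
  have block: "(\<chi> r. (controlled U *v ?x) $ (d, r)) = ?h *s (if d = 0 then \<phi> else U *v \<phi>)" for d
    by (simp add: controlled_mult_block x vec.scale)
  have y: "(controlled U *v ?x) $ (d, r) = ?h * (if d = 0 then \<phi> else U *v \<phi>) $ r" for d r
    using arg_cong[OF block[of d], of "\<lambda>w. w $ r"] by simp
  have sqrt2: "complex_of_real (sqrt 2) * complex_of_real (sqrt 2) = 2"
    by (simp flip: of_real_mult)
  have half: "(1 / 2) *\<^sub>R z = z / 2" for z :: complex
    by (simp add: scaleR_conv_of_real)
  show ?thesis
    using c
    by (auto simp: dagger_ket_tensor_id_mult vec_eq_iff hadamard_test_state_def kron_mult_nth y
        UNIV_qubit hadamard_nth sqrt2 half add_divide_distrib
        diff_divide_distrib)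
qed

text \<open>Parallelogram law: in the squared norms of the sum and the difference of the unit
  vectors \<phi> and U\<phi> the cross terms cancel.\<close>

lemma norm_hadamard_test_state:
  fixes U :: "('a::{finite,zero} \<times> 's::{finite,zero}) op"
  assumes "block_encoding U B" and "norm (P *v ket 0) = 1"
  shows "norm (hadamard_test_state P U) = 1"
proof -
  define \<phi> where "\<phi> = ket_tensor_id (ket (0::'a)) *v (P *v ket 0)"
  have \<phi>: "\<phi> \<bullet> \<phi> = 1" "(U *v \<phi>) \<bullet> (U *v \<phi>) = 1"
    using assms block_encodingD(2)[OF assms(1), of "P *v ket 0"]
    by (simp_all add: \<phi>_def norm_mult_isometry ket_tensor_id_isometry dot_square_norm)
  have "(norm (hadamard_test_state P U))\<^sup>2
      = (norm ((1 / 2) *\<^sub>R (\<phi> + U *v \<phi>)))\<^sup>2 + (norm ((1 / 2) *\<^sub>R (\<phi> - U *v \<phi>)))\<^sup>2"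
    by (subst sum_norm_blocks[symmetric]) (simp add: UNIV_qubit hadamard_test_state_block \<phi>_def)
  also have "\<dots> = 1"
    using \<phi> by (simp add: power_divide power2_norm_eq_inner inner_simps inner_commute
        flip: add_divide_distrib)
  finally show ?thesis
    by - (rule power2_eq_imp_eq, simp_all)
qed

section \<open>The measurement and its expected value\<close>

lemma sets_measure_control_ancilla: "sets (measure_control_ancilla v) = UNIV"
  by (simp add: measure_control_ancilla_def sets_point_measure)

lemma prob_space_measure_control_ancilla:
  assumes "norm v = 1"
  shows "prob_space (measure_control_ancilla v)"
proof
  show "emeasure (measure_control_ancilla v) (space (measure_control_ancilla v)) = 1"
    by (simp add: measure_control_ancilla_def space_point_measure emeasure_point_measure_finite
        sum_UNIV_times sum_ennreal sum_nonneg sum_norm_blocks assms)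
qed

text \<open>This makes the measurement a probability kernel, as the laws of \<open>bind\<close>
  require. Each event has as its probability a finite sum of squared norms of linear images of the
  state, and linear maps are continuous here.\<close>

lemma measurable_measure_control_ancilla:
  fixes f :: "'w \<Rightarrow> (2 \<times> 'a::finite \<times> 's::finite) vector"
  assumes "f \<in> borel_measurable \<Omega>" and "\<And>\<omega>. \<omega> \<in> space \<Omega> \<Longrightarrow> norm (f \<omega>) = 1"
  shows "(\<lambda>\<omega>. measure_control_ancilla (f \<omega>)) \<in> measurable \<Omega> (subprob_algebra (count_space UNIV))"
proof (rule measurable_subprob_algebra)
  fix A :: "(2 \<times> 'a) set"
  have [measurable]: "(\<lambda>\<omega>. B *v (C *v f \<omega>)) \<in> borel_measurable \<Omega>"
    for B :: "complex^('a \<times> 's)^'s" and C :: "complex^(2 \<times> 'a \<times> 's)^('a \<times> 's)"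
    by (intro borel_measurable_continuous_on[OF _ assms(1)] linear_continuous_on)
      (simp add: matrix_vector_mul_assoc)
  show "(\<lambda>\<omega>. emeasure (measure_control_ancilla (f \<omega>)) A) \<in> borel_measurable \<Omega>"
    by (simp add: measure_control_ancilla_def emeasure_point_measure_finite split_beta)
qed (auto simp: sets_measure_control_ancilla intro: prob_space_imp_subprob_space
       prob_space_measure_control_ancilla assms)

lemma expectation_outcome_value:
  fixes U :: "('a::{finite,zero} \<times> 's::{finite,zero}) op"
  assumes "block_encoding U B"
  shows "(\<integral>x. outcome_value x \<partial>measure_control_ancilla (hadamard_test_state P U))
    = Re (sandwich (P *v ket 0) B (P *v ket 0))"
proof -
  define v where "v = hadamard_test_state P U"
  define q where "q c j = (norm (dagger (ket_tensor_id (ket (j::'a))) *v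
      (dagger (ket_tensor_id (ket (c::2))) *v v)))\<^sup>2" for c j
  have "A *v (r *\<^sub>R x) = r *\<^sub>R (A *v x)" for r and x :: "('a \<times> 's) vector" and A :: "(('a \<times> 's) vector, 's) vec"
    by (simp add: linear_scale)
  then have q: "q c 0 = (norm ((1 / 2) *\<^sub>R (if c = 0 then P *v ket 0 + B *v (P *v ket 0)
      else P *v ket 0 - B *v (P *v ket 0))))\<^sup>2" for c
    using block_encodingD(1)[OF assms, of "P *v ket 0"]
    by (simp add: q_def v_def hadamard_test_state_block
        matrix_vector_right_distrib matrix_vector_mult_diff_distrib
        matrix_vector_mul_assoc[of _ "ket_tensor_id _"]
        ket_tensor_id_isometry)
  have "(\<integral>x. outcome_value x \<partial>measure_control_ancilla v) = (\<Sum>x\<in>UNIV. q (fst x) (snd x) * outcome_value x)"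
    unfolding measure_control_ancilla_def split_beta q_def[symmetric]
    by (subst lebesgue_integral_point_measure_finite) (auto simp: q_def)
  \<comment> \<open>All other outcomes have value 0.\<close>
  also have "\<dots> = (\<Sum>x\<in>{(0, 0), (1, 0)}. q (fst x) (snd x) * outcome_value x)"
    by (rule sum.mono_neutral_right) (auto simp: outcome_value_def)
  also have "\<dots> = q 0 0 - q 1 0"
    by (simp add: outcome_value_def)
  \<comment> \<open>Real polarization: for a = P|0> and b = Ba, the numbers |a + b|^2 / 4 and |a -
    b|^2 / 4 differ by the real inner product of a and b.\<close>
  also have "\<dots> = Re (sandwich (P *v ket 0) B (P *v ket 0))"
    by (simp add: q sandwich_Re power_divide power2_norm_eq_inner inner_simps inner_commute
        add_divide_distrib diff_divide_distrib)
  finally show ?thesis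
    by (simp add: v_def)
qed

section \<open>Averaging over the random sample\<close>

lemma borel_measurable_hadamard_test_state:
  fixes U :: "'w \<Rightarrow> ('a::{finite,zero} \<times> 's::{finite,zero}) op"
  assumes "U \<in> borel_measurable \<Omega>"
  shows "(\<lambda>\<omega>. hadamard_test_state P (U \<omega>)) \<in> borel_measurable \<Omega>"
proof (rule borel_measurable_continuous_on[OF _ assms])
  show "continuous_on UNIV (\<lambda>V :: ('a \<times> 's) op. hadamard_test_state P V)"
    unfolding hadamard_test_state_def controlled_def kron_def matrix_vector_mult_def plus_vec_def
    by (intro continuous_intros)
qed

text \<open>A Bochner integral without integrability defaults to 0, so this is what makes the
  expectation of the random matrix meaningful. Each entry is a coordinate of the image of a basis
  vector, hence bounded by the spectral norm.\<close>

lemma integrable_bounded_spectral_norm: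
  fixes A :: "'w \<Rightarrow> complex^'n::finite^'m::finite"
  assumes "finite_measure \<Omega>" and "A \<in> borel_measurable \<Omega>"
    and "\<And>\<omega>. \<omega> \<in> space \<Omega> \<Longrightarrow> spectral_norm (A \<omega>) \<le> b"
  shows "integrable \<Omega> A"
proof (rule finite_measure.integrable_const_bound[OF assms(1)])
  \<comment> \<open>A crude bound: the Euclidean norm is estimated by a sum, within each row and
    then over the rows.\<close>
  have "norm (A \<omega>) \<le> real CARD('m) * (real CARD('n) * b)" if "\<omega> \<in> space \<Omega>" for \<omega>
  proof -
    have "cmod (A \<omega> $ i $ j) \<le> b" for i j
    proof -
      have "cmod (A \<omega> $ i $ j) = cmod ((A \<omega> *v ket j) $ i)"
        by (simp add: matrix_vector_mult_def ket_nth sum_UNIV_of_bool)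
      also have "\<dots> \<le> norm (A \<omega> *v ket j)"
        by (rule Finite_Cartesian_Product.norm_nth_le)
      also have "\<dots> \<le> spectral_norm (A \<omega>) * norm (ket j :: 'n vector)"
        by (intro onorm matrix_vector_mul_bounded_linear)
      also have "\<dots> \<le> b"
        using assms(3)[OF that] by (simp add: ket_def)
      finally show ?thesis .
    qed
    then have "norm (A \<omega> $ i) \<le> real CARD('n) * b" for i
      unfolding norm_vec_def by (intro order.trans[OF L2_set_le_sum] sum_bounded_above) auto
    then show ?thesis
      unfolding norm_vec_def[of "A \<omega>"] by (intro order.trans[OF L2_set_le_sum] sum_bounded_above) auto
  qed
  then show "AE \<omega> in \<Omega>. norm (A \<omega>) \<le> real CARD('m) * (real CARD('n) * b)"
    by simp
qed fact

text \<open>The integrand is a real-linear functional of the matrix, bounded because the dimension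
  is finite, so it commutes with the integral.\<close>

lemma integral_Re_sandwich:
  fixes A :: "'w \<Rightarrow> complex^'n::finite^'m::finite"
  assumes "integrable \<Omega> A"
  shows "(\<integral>\<omega>. Re (sandwich u (A \<omega>) v) \<partial>\<Omega>) = Re (sandwich u (\<integral>\<omega>. A \<omega> \<partial>\<Omega>) v)"
proof (rule integral_bounded_linear[OF _ assms])
  have "(r *\<^sub>R B) *v v = r *\<^sub>R (B *v v)" for r and B :: "complex^'n^'m"
    by (simp add: vec_eq_iff matrix_vector_mult_def scaleR_sum_right)
  then have "linear (\<lambda>B. Re (sandwich u B v))"
    by (intro linearI) (simp_all add: sandwich_Re matrix_vector_mult_add_rdistrib inner_simps)
  then show "bounded_linear (\<lambda>B. Re (sandwich u B v))"
    by (simp add: linear_conv_bounded_linear)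
qed

section \<open>Concentration of the mean and the number of runs\<close>

lemma prob_mean_deviation_le:
  fixes Y :: "'x \<Rightarrow> real"
  assumes "prob_space N" and Y: "Y \<in> borel_measurable N" and "\<And>x. \<bar>Y x\<bar> \<le> 1"
    and "0 < M" and "0 \<le> \<epsilon>"
  shows "\<P>(x in Pi\<^sub>M {1..M} (\<lambda>_. N). \<bar>(\<Sum>m = 1..M. Y (x m)) / real M - integral\<^sup>L N Y\<bar> \<le> \<epsilon>)
    \<ge> 1 - 2 * exp (- real M * \<epsilon>\<^sup>2 / 2)"
proof -
  let ?P = "Pi\<^sub>M {1..M} (\<lambda>_. N)"
  interpret N: prob_space N by fact
  interpret P: product_prob_space "\<lambda>_. N" "{1..M}" ..
  interpret P: prob_space ?P
    by (rule P.prob_space_axioms)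
  have Yi[measurable]: "(\<lambda>x. Y (x i)) \<in> borel_measurable ?P" if "i \<in> {1..M}" for i
    using Y that by measurable
  \<comment> \<open>Coordinate 1 will represent the common distribution of the runs.\<close>
  have one: "1 \<in> {1..M}" using \<open>0 < M\<close> by simp
  have component: "distr ?P borel (\<lambda>x. Y (x i)) = distr N borel Y" if "i \<in> {1..M}" for i
  proof -
    have "distr ?P borel (\<lambda>x. Y (x i)) = distr (distr ?P N (\<lambda>x. x i)) borel Y"
      using Y that by (subst distr_distr) (auto simp: o_def)
    also have "distr ?P N (\<lambda>x. x i) = N"
      using that by (intro distr_PiM_component[of "{1..M}" "\<lambda>_. N"] N.prob_space_axioms)
    finally show ?thesis .
  qed
  have indep: "P.indep_vars (\<lambda>_. borel) (\<lambda>i x. Y (x i)) {1..M}"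
  proof -
    \<comment> \<open>Independence means that the joint law is the product of the marginals. The
      joint map is a restriction to the index set, which is the identity on the product space
      because its points are extensional.\<close>
    have "P.indep_vars (\<lambda>_. N) (\<lambda>i x. x i) {1..M}"
    proof (subst P.indep_vars_iff_distr_eq_PiM')
      have "distr ?P ?P (\<lambda>x. restrict x {1..M}) = distr ?P ?P (\<lambda>x. x)"
        by (intro distr_cong) (auto simp: space_PiM)
      also have "\<dots> = ?P" by (rule distr_id)
      also have "\<dots> = Pi\<^sub>M {1..M} (\<lambda>i. distr ?P N (\<lambda>x. x i))"
        by (intro PiM_cong refl distr_PiM_component[of "{1..M}" "\<lambda>_. N", symmetric] N.prob_space_axioms)
      finally show "distr ?P ?P (\<lambda>x. restrict x {1..M}) = Pi\<^sub>M {1..M} (\<lambda>i. distr ?P N (\<lambda>x. x i))" .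
    qed (use one in auto)
    then show ?thesis
      by (rule P.indep_vars_compose2) (use Y in auto)
  qed
  have mean: "P.expectation (\<lambda>x. Y (x 1)) = integral\<^sup>L N Y"
  proof -
    have "P.expectation (\<lambda>x. Y (x 1)) = (\<integral>y. y \<partial>distr ?P borel (\<lambda>x. Y (x 1)))"
      by (rule integral_distr[symmetric]) (use Yi[OF one] in auto)
    also have "\<dots> = integral\<^sup>L N Y"
      unfolding component[OF one] by (rule integral_distr) (use Y in auto)
    finally show ?thesis .
  qed
  interpret H: Hoeffding_ineq_iid ?P "{1..M}" "\<lambda>i x. Y (x i)" "\<lambda>x. Y (x 1)" "-1" 1 "integral\<^sup>L N Y"
  proof unfold_locales
    show "P.indep_vars (\<lambda>_. borel) (\<lambda>i x. Y (x i)) {1..M}" by (rule indep)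
    show "distr ?P borel (\<lambda>x. Y (x i)) = distr ?P borel (\<lambda>x. Y (x 1))" if "i \<in> {1..M}" for i
      unfolding component[OF that] component[OF one] ..
    show "(\<lambda>x. Y (x 1)) \<in> borel_measurable ?P" by (rule Yi[OF one])
    have "Y y \<in> {-1..1}" for y
      using assms(3)[of y] by (simp add: abs_le_iff)
    then show "AE x in ?P. Y (x 1) \<in> {-1..1}" by simp
    show "integral\<^sup>L N Y \<equiv> P.expectation (\<lambda>x. Y (x 1))"
      by (simp only: mean)
  qed simp
  define D where "D x = \<bar>(\<Sum>m = 1..M. Y (x m)) / real M - integral\<^sup>L N Y\<bar>" for x
  have [measurable]: "D \<in> borel_measurable ?P"
    unfolding D_def[abs_def] by measurable
  \<comment> \<open>Hoeffding's exponent 2 M \<epsilon>^2 / (b - a)^2 with b - a = 2.\<close>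
  have "P.prob {x \<in> space ?P. \<epsilon> \<le> D x} \<le> 2 * exp (- real M * \<epsilon>\<^sup>2 / 2)"
    using H.Hoeffding_ineq_abs_ge'[OF \<open>0 \<le> \<epsilon>\<close>] one by (auto simp: D_def mult_ac)
  \<comment> \<open>Failure is a strict inequality, so it lies inside the event that Hoeffding
    bounds.\<close>
  moreover have "P.prob {x \<in> space ?P. \<not> D x \<le> \<epsilon>} \<le> P.prob {x \<in> space ?P. \<epsilon> \<le> D x}"
    by (rule P.finite_measure_mono) (auto simp del: One_nat_def)
  moreover have "P.prob {x \<in> space ?P. \<not> D x \<le> \<epsilon>} = 1 - P.prob {x \<in> space ?P. D x \<le> \<epsilon>}"
    by (rule P.prob_neg) measurable
  ultimately show ?thesis
    unfolding D_def by linarith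
qed

lemma num_runs_bigo:
  assumes "\<delta>\<^sub>0 < 1"
  shows "(\<lambda>(\<epsilon>, \<delta>). real (num_runs \<epsilon> \<delta>))
    \<in> O[principal ({0<..<1} \<times> {0<..\<delta>\<^sub>0})](\<lambda>(\<epsilon>, \<delta>). 1 / \<epsilon>\<^sup>2 * ln (1 / \<delta>))"
proof -
  define L where "L = ln (1 / \<delta>\<^sub>0)"
  \<comment> \<open>Since ln (1 / \<delta>) is at least \<open>L\<close>, the summand ln 2 of ln (2
    / \<delta>) costs ln 2 / L, and rounding up costs 1 / L because 1 / \<epsilon>^2 is at least
    1.\<close>
  have "real (num_runs \<epsilon> \<delta>) \<le> (2 * (ln 2 / L + 1) + 1 / L) * \<bar>1 / \<epsilon>\<^sup>2 * ln (1 / \<delta>)\<bar>"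
    if "0 < \<epsilon>" "\<epsilon> < 1" "0 < \<delta>" "\<delta> \<le> \<delta>\<^sub>0" for \<epsilon> \<delta>
  proof -
    have L: "0 < L" "L \<le> ln (1 / \<delta>)"
      using that assms by (auto simp: L_def ln_div)
    have e: "1 \<le> 1 / \<epsilon>\<^sup>2"
      using that by (simp add: power_le_one)
    have "ln (2 / \<delta>) = ln 2 * 1 + ln (1 / \<delta>)"
      using that by (simp add: ln_div)
    also have "\<dots> \<le> ln 2 * (ln (1 / \<delta>) / L) + ln (1 / \<delta>)"
      using L by (intro add_mono mult_left_mono) auto
    also have "\<dots> = (ln 2 / L + 1) * ln (1 / \<delta>)"
      by (simp add: algebra_simps)
    finally have ln: "ln (2 / \<delta>) \<le> (ln 2 / L + 1) * ln (1 / \<delta>)" .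
    have nonneg: "0 \<le> 2 / \<epsilon>\<^sup>2 * ln (2 / \<delta>)"
      using that assms by simp
    have "real (num_runs \<epsilon> \<delta>) \<le> 2 / \<epsilon>\<^sup>2 * ln (2 / \<delta>) + 1"
      using nonneg by (simp add: num_runs_def)
    also have "\<dots> \<le> 2 / \<epsilon>\<^sup>2 * ((ln 2 / L + 1) * ln (1 / \<delta>)) + 1 / \<epsilon>\<^sup>2 * (ln (1 / \<delta>) / L)"
    proof (intro add_mono mult_left_mono ln)
      have "1 * 1 \<le> 1 / \<epsilon>\<^sup>2 * (ln (1 / \<delta>) / L)"
        using e L by (intro mult_mono) auto
      then show "1 \<le> 1 / \<epsilon>\<^sup>2 * (ln (1 / \<delta>) / L)" by simp
    qed auto
    also have "\<dots> = (2 * (ln 2 / L + 1) + 1 / L) * (1 / \<epsilon>\<^sup>2 * ln (1 / \<delta>))"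
      by (simp add: algebra_simps)
    also have "1 / \<epsilon>\<^sup>2 * ln (1 / \<delta>) = \<bar>1 / \<epsilon>\<^sup>2 * ln (1 / \<delta>)\<bar>"
      using L by simp
    finally show ?thesis .
  qed
  then show ?thesis
    by (intro bigoI[of _ "2 * (ln 2 / L + 1) + 1 / L"]) (auto simp: eventually_principal)
qed

theorem theorem14:
  fixes \<Omega> :: "'w measure"
    and \<psi> :: "'s::{finite,zero} vector"
    and O\<psi> :: "'s op"
    and Ot :: "'w \<Rightarrow> 's op"
    and U :: "'w \<Rightarrow> ('a::{finite,zero} \<times> 's) op"
  assumes "prob_space \<Omega>"
    and "norm \<psi> = 1"
    and "Ot \<in> borel_measurable \<Omega>"
    and "\<And>\<omega>. \<omega> \<in> space \<Omega> \<Longrightarrow> spectral_norm (Ot \<omega>) \<le> 1"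
    and "hermitian (prob_space.expectation \<Omega> Ot)"
    and "unitary O\<psi>" and "O\<psi> *v ket 0 = \<psi>"
    and "U \<in> borel_measurable \<Omega>"
    and "\<And>\<omega>. \<omega> \<in> space \<Omega> \<Longrightarrow> block_encoding (U \<omega>) (Ot \<omega>)"
  shows "(\<forall>\<delta>\<^sub>0<1. (\<lambda>(\<epsilon>, \<delta>). real (num_runs \<epsilon> \<delta>))
            \<in> O[principal ({0<..<1} \<times> {0<..\<delta>\<^sub>0})](\<lambda>(\<epsilon>, \<delta>). 1 / \<epsilon>\<^sup>2 * ln (1 / \<delta>))) \<and>
         (\<forall>\<epsilon>\<in>{0<..<1}. \<forall>\<delta>\<in>{0<..<1}.
            \<P>(x in hadamard_test (num_runs \<epsilon> \<delta>) \<Omega> O\<psi> U.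
               cmod (of_real (hadamard_test_output (num_runs \<epsilon> \<delta>) x)
                     - sandwich \<psi> (prob_space.expectation \<Omega> Ot) \<psi>) \<le> \<epsilon>)
            \<ge> 1 - \<delta>)"
proof (intro conjI allI impI ballI num_runs_bigo)
  fix \<epsilon> \<delta> :: real
  assume \<epsilon>: "\<epsilon> \<in> {0<..<1}" and \<delta>: "\<delta> \<in> {0<..<1}"
  interpret \<Omega>: prob_space \<Omega> by fact
  define N where "N = hadamard_test_run \<Omega> O\<psi> U"
  define M where "M = num_runs \<epsilon> \<delta>"
  let ?K = "\<lambda>\<omega>. measure_control_ancilla (hadamard_test_state O\<psi> (U \<omega>))"
  have norm: "norm (hadamard_test_state O\<psi> (U \<omega>)) = 1" if "\<omega> \<in> space \<Omega>" for \<omega>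
    using assms that by (intro norm_hadamard_test_state) auto
  have K: "?K \<in> measurable \<Omega> (subprob_algebra (count_space UNIV))"
    by (intro measurable_measure_control_ancilla borel_measurable_hadamard_test_state assms norm)
  have N: "prob_space N"
    unfolding N_def hadamard_test_run_def
    by (intro \<Omega>.prob_space_bind[OF _ K] AE_I2 prob_space_measure_control_ancilla norm)
  \<comment> \<open>Every set of outcomes is measurable, so \<open>outcome_value\<close> is a random
    variable on \<open>N\<close>.\<close>
  have sets_N: "sets N = sets (count_space UNIV)"
    unfolding N_def hadamard_test_run_def
    by (intro sets_bind \<Omega>.not_empty) (simp add: sets_measure_control_ancilla)
  have bound: "\<bar>outcome_value x\<bar> \<le> 1" for x :: "2 \<times> 'a"
    by (simp add: outcome_value_def)
  \<comment> \<open>Law of total expectation; the two bounds 1 are for the outcome values and for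
    the mass of the kernel.\<close>
  have "integral\<^sup>L N outcome_value = (\<integral>\<omega>. \<integral>x. outcome_value x \<partial>?K \<omega> \<partial>\<Omega>)"
    unfolding N_def hadamard_test_run_def
    by (rule integral_bind[where B = 1 and B' = 1, OF _ _ K])
      (auto simp: bound \<Omega>.finite_measure_axioms norm
        intro!: AE_I2 prob_space.emeasure_le_1 prob_space_measure_control_ancilla)
  also have "\<dots> = (\<integral>\<omega>. Re (sandwich \<psi> (Ot \<omega>) \<psi>) \<partial>\<Omega>)"
    using assms by (intro Bochner_Integration.integral_cong) (auto simp: expectation_outcome_value)
  also have "\<dots> = Re (sandwich \<psi> (\<Omega>.expectation Ot) \<psi>)"
    using assms by (intro integral_Re_sandwich integrable_bounded_spectral_norm \<Omega>.finite_measure_axioms)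
  \<comment> \<open>The test estimates only a real part; Hermiticity of the mean removes the
    imaginary part, so the complex error becomes a real deviation.\<close>
  finally have "sandwich \<psi> (\<Omega>.expectation Ot) \<psi> = of_real (integral\<^sup>L N outcome_value)"
    using sandwich_hermitian_real[OF assms(5)] by (simp add: complex_eq_iff)
  then have "cmod (of_real y - sandwich \<psi> (\<Omega>.expectation Ot) \<psi>) = \<bar>y - integral\<^sup>L N outcome_value\<bar>" for y
    by (simp flip: of_real_diff)
  moreover have "1 - \<delta> \<le> \<P>(x in hadamard_test M \<Omega> O\<psi> U.
      \<bar>hadamard_test_output M x - integral\<^sup>L N outcome_value\<bar> \<le> \<epsilon>)"
  proof -
    \<comment> \<open>Positive because 2 / \<delta> > 1; hence at least one run takes place.\<close>
    have "0 < 2 / \<epsilon>\<^sup>2 * ln (2 / \<delta>)"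
      using \<epsilon> \<delta> by simp
    moreover have le: "2 / \<epsilon>\<^sup>2 * ln (2 / \<delta>) \<le> real M"
      unfolding M_def num_runs_def by linarith
    ultimately have M: "0 < M" by linarith
    \<comment> \<open>This choice of \<open>M\<close> brings the two-sided Hoeffding tail down to at
      most \<delta>.\<close>
    have "ln (2 / \<delta>) \<le> real M * \<epsilon>\<^sup>2 / 2"
      using le \<epsilon> by (simp add: field_simps)
    then have "exp (- real M * \<epsilon>\<^sup>2 / 2) \<le> exp (- ln (2 / \<delta>))"
      by simp
    also have "\<dots> = \<delta> / 2"
      using \<delta> by (simp add: exp_minus)
    finally show ?thesis
      using prob_mean_deviation_le[of N outcome_value M \<epsilon>] N bound M \<epsilon>
      by (simp add: hadamard_test_def hadamard_test_output_def N_def[symmetric]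
          measurable_cong_sets[OF sets_N refl])
  qed
  ultimately show "1 - \<delta> \<le> \<P>(x in hadamard_test (num_runs \<epsilon> \<delta>) \<Omega> O\<psi> U.
      cmod (of_real (hadamard_test_output (num_runs \<epsilon> \<delta>) x)
        - sandwich \<psi> (\<Omega>.expectation Ot) \<psi>) \<le> \<epsilon>)"
    by (simp add: M_def)
qed

end
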